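(* There exist a market $(S,B,\mathbf v,G)$ (a general buyer-seller network with unit-demand buyers and unit-supply sellers) and a transaction fee $\alpha\in[0,1]$ such that there is no pure Platform Equilibrium at fee $\alpha$.
   Context: A market $(S,B,\mathbf v,G)$ consists of a finite set $B=\{1,\dots,n\}$ of buyers, a finite set $S=\{1,\dots,m\}$ of sellers (each owning one item), values $v_{ij}\ge 0$ of buyer $i$ for seller $j$'s item (each buyer is unit-demand), and a bipartite graph $G$ between $B$ and $S$ whose edges are the pairs that can transact directly. $W(S',B',G)$ denotes the maximum of $\sum v_{ij}$ over matchings between $B'\subseteq B$ and $S'\subseteq S$ that use only edges of $G$. For a set $P\subseteq S$ of sellers joining the platform, $G(P)$ is the graph obtained from $G$ by adding all edges between $P$ and $B$. The market then clears at the maximum competitive (Walrasian) equilibrium prices with respect to $G(P)$, which equal $p_j(P)=W(S,B,G(P))-W(S\setminus\{j\},B,G(P))$. At fee $\alpha$, a seller $j\in P$ has utility $(1-\alpha)p_j(P)$ and a seller $j\notin P$ has utility $p_j(P)$. A set $P\subseteq S$ is a pure Platform Equilibrium at fee $\alpha$ if for all $j\in P$: $(1-\alpha)p_j(P)\ge p_j(P\setminus\{j\})$, and for all $j\notin P$: $p_j(P)\ge(1-\alpha)p_j(P\cup\{j\})$. *)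

theory Defs
  imports Complex_Main
begin

section \<open>Markets and matchings\<close>

text \<open>Edges and matchings are sets of pairs (buyer, seller).\<close>

definition market :: "'s set \<Rightarrow> 'b set \<Rightarrow> ('b \<Rightarrow> 's \<Rightarrow> real) \<Rightarrow> ('b \<times> 's) set \<Rightarrow> bool" where
  "market S B v G \<longleftrightarrow>
     finite S \<and> finite B \<and> G \<subseteq> B \<times> S \<and> (\<forall>i\<in>B. \<forall>j\<in>S. 0 \<le> v i j)"

definition matching :: "'s set \<Rightarrow> 'b set \<Rightarrow> ('b \<times> 's) set \<Rightarrow> ('b \<times> 's) set \<Rightarrow> bool" where
  "matching S B G M \<longleftrightarrow> M \<subseteq> G \<inter> (B \<times> S) \<and> inj_on fst M \<and> inj_on snd M"

definition welfare :: "('b \<Rightarrow> 's \<Rightarrow> real) \<Rightarrow> ('b \<times> 's) set \<Rightarrow> real" where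
  "welfare v M = (\<Sum>(i, j)\<in>M. v i j)"

definition max_welfare ::
  "'s set \<Rightarrow> 'b set \<Rightarrow> ('b \<Rightarrow> 's \<Rightarrow> real) \<Rightarrow> ('b \<times> 's) set \<Rightarrow> real" where
  "max_welfare S B v G = Max (welfare v ` {M. matching S B G M})"

section \<open>Platform equilibrium\<close>

definition platform_graph :: "'b set \<Rightarrow> ('b \<times> 's) set \<Rightarrow> 's set \<Rightarrow> ('b \<times> 's) set" where
  "platform_graph B G P = G \<union> B \<times> P"

text \<open>
  The price of seller \<open>j\<close> in the graph \<open>H\<close>, as a difference of optimal welfares.
  Theorem \<open>price_is_max_competitive_price\<close> below shows that, in every market, these are the
  maximum competitive (Walrasian) equilibrium prices.
\<close>

definition price ::
  "'s set \<Rightarrow> 'b set \<Rightarrow> ('b \<Rightarrow> 's \<Rightarrow> real) \<Rightarrow> ('b \<times> 's) set \<Rightarrow> 's \<Rightarrow> real" where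
  "price S B v H j = max_welfare S B v H - max_welfare (S - {j}) B v H"

definition platform_price ::
  "'s set \<Rightarrow> 'b set \<Rightarrow> ('b \<Rightarrow> 's \<Rightarrow> real) \<Rightarrow> ('b \<times> 's) set \<Rightarrow> 's set \<Rightarrow> 's \<Rightarrow> real" where
  "platform_price S B v G P j = price S B v (platform_graph B G P) j"

definition seller_utility ::
  "'s set \<Rightarrow> 'b set \<Rightarrow> ('b \<Rightarrow> 's \<Rightarrow> real) \<Rightarrow> ('b \<times> 's) set \<Rightarrow> real \<Rightarrow> 's set \<Rightarrow> 's \<Rightarrow> real" where
  "seller_utility S B v G \<alpha> P j =
     (if j \<in> P then (1 - \<alpha>) * platform_price S B v G P j else platform_price S B v G P j)"

definition pure_platform_equilibrium ::
  "'s set \<Rightarrow> 'b set \<Rightarrow> ('b \<Rightarrow> 's \<Rightarrow> real) \<Rightarrow> ('b \<times> 's) set \<Rightarrow> real \<Rightarrow> 's set \<Rightarrow> bool" where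
  "pure_platform_equilibrium S B v G \<alpha> P \<longleftrightarrow>
     P \<subseteq> S \<and>
     (\<forall>j\<in>P. seller_utility S B v G \<alpha> P j \<ge> seller_utility S B v G \<alpha> (P - {j}) j) \<and>
     (\<forall>j\<in>S - P. seller_utility S B v G \<alpha> P j \<ge> seller_utility S B v G \<alpha> (P \<union> {j}) j)"

lemma pure_platform_equilibrium_iff:
  "pure_platform_equilibrium S B v G \<alpha> P \<longleftrightarrow>
     P \<subseteq> S \<and>
     (\<forall>j\<in>P. (1 - \<alpha>) * platform_price S B v G P j \<ge> platform_price S B v G (P - {j}) j) \<and>
     (\<forall>j\<in>S - P. platform_price S B v G P j \<ge> (1 - \<alpha>) * platform_price S B v G (P \<union> {j}) j)"
  by (simp add: pure_platform_equilibrium_def seller_utility_def)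

section \<open>Prices as maximum competitive prices\<close>

definition competitive_equilibrium ::
  "'s set \<Rightarrow> 'b set \<Rightarrow> ('b \<Rightarrow> 's \<Rightarrow> real) \<Rightarrow> ('b \<times> 's) set \<Rightarrow> ('b \<times> 's) set \<Rightarrow> ('s \<Rightarrow> real) \<Rightarrow> bool"
  where
  "competitive_equilibrium S B v H M p \<longleftrightarrow>
     matching S B H M \<and>
     (\<forall>j\<in>S. 0 \<le> p j) \<and>
     (\<forall>j\<in>S - snd ` M. p j = 0) \<and>
     (\<forall>(i, j)\<in>M. 0 \<le> v i j - p j \<and> (\<forall>k. (i, k) \<in> H \<longrightarrow> v i k - p k \<le> v i j - p j)) \<and>
     (\<forall>i\<in>B - fst ` M. \<forall>k. (i, k) \<in> H \<longrightarrow> v i k - p k \<le> 0)"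

definition competitive_prices ::
  "'s set \<Rightarrow> 'b set \<Rightarrow> ('b \<Rightarrow> 's \<Rightarrow> real) \<Rightarrow> ('b \<times> 's) set \<Rightarrow> ('s \<Rightarrow> real) \<Rightarrow> bool" where
  "competitive_prices S B v H p \<longleftrightarrow> (\<exists>M. competitive_equilibrium S B v H M p)"

lemma finite_matchings:
  assumes "finite S" "finite B"
  shows "finite {M. matching S B H M}"
proof (rule finite_subset)
  show "{M. matching S B H M} \<subseteq> Pow (B \<times> S)" by (auto simp: matching_def)
  show "finite (Pow (B \<times> S))" using assms by simp
qed

lemma matching_finite:
  assumes "finite S" "finite B" "matching S B H M"
  shows "finite M"
  using assms by (auto simp: matching_def intro: finite_subset[of M "B \<times> S"])

lemma welfare_le_max_welfare:
  assumes "finite S" "finite B" "matching S B H M"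
  shows "welfare v M \<le> max_welfare S B v H"
  unfolding max_welfare_def using assms finite_matchings[of S B H] by (intro Max_ge) auto

lemma max_welfare_attained:
  assumes "finite S" "finite B"
  obtains M where "matching S B H M" "welfare v M = max_welfare S B v H"
proof -
  have "matching S B H {}" by (simp add: matching_def)
  then have "max_welfare S B v H \<in> welfare v ` {M. matching S B H M}"
    unfolding max_welfare_def using finite_matchings[OF assms, of H] by (intro Max_in) auto
  then show ?thesis using that by auto
qed

lemma matching_mono:
  "matching S B H M \<Longrightarrow> S \<subseteq> S' \<Longrightarrow> matching S' B H M"
  by (auto simp: matching_def)

lemma matching_subset:
  "matching S B H M \<Longrightarrow> M' \<subseteq> M \<Longrightarrow> matching S B H M'"
  by (auto simp: matching_def intro: inj_on_subset)

lemma matching_avoid: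
  "matching S B H M \<Longrightarrow> j \<notin> snd ` M \<Longrightarrow> matching (S - {j}) B H M"
  by (auto simp: matching_def) (force)

lemma matching_insert:
  assumes "matching S B H M" "(i, j) \<in> H" "i \<in> B" "j \<in> S" "i \<notin> fst ` M" "j \<notin> snd ` M"
  shows "matching S B H (insert (i, j) M)"
  using assms by (auto simp: matching_def)

lemma welfare_insert:
  assumes "finite M" "(i, j) \<notin> M"
  shows "welfare v (insert (i, j) M) = v i j + welfare v M"
  using assms by (simp add: welfare_def)

lemma welfare_remove:
  assumes "finite M" "(i, j) \<in> M"
  shows "welfare v (M - {(i, j)}) = welfare v M - v i j"
  using assms by (simp add: welfare_def sum_diff1)

text \<open>
  A buyer-seller multigraph made of two matchings and one further edge, of maximum degree two,
  splits into two matchings again (by following an alternating path).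
\<close>

lemma rematch:
  assumes fin: "finite S" "finite B"
    and "matching S B H A" "matching S B H N"
    and "(i, k) \<in> H" "i \<in> B" "k \<in> S" "i \<notin> fst ` A" "k \<notin> snd ` N"
  shows "\<exists>N1 N2. matching S B H N1 \<and> matching S B H N2 \<and>
           welfare v N1 + welfare v N2 = welfare v A + welfare v N + v i k \<and>
           N1 \<union> N2 = insert (i, k) (A \<union> N) \<and> N1 \<inter> N2 \<subseteq> A \<inter> N \<and>
           (i, k) \<in> N1 \<and> snd ` N1 \<subseteq> insert k (snd ` N)"
  using assms(3-)
proof (induction "card N" arbitrary: A N i k rule: less_induct)
  case less
  note A = less.prems(1) and N = less.prems(2) and ik = less.prems(3-7)
  have finA: "finite A" and finN: "finite N" using matching_finite fin A N by blast+
  have ikA: "(i, k) \<notin> A" and ikN: "(i, k) \<notin> N" using ik by force+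
  show ?case
  proof (cases "i \<in> fst ` N")
    case False
    have "matching S B H (insert (i, k) N)" using matching_insert[OF N] ik False by blast
    moreover have "welfare v (insert (i, k) N) = v i k + welfare v N"
      by (rule welfare_insert[OF finN ikN])
    ultimately show ?thesis
      using A ikA by - (rule exI[of _ "insert (i, k) N"], rule exI[of _ A], auto)
  next
    case True
    then obtain l where il: "(i, l) \<in> N" by force
    have ilA: "(i, l) \<notin> A" using ik by force
    have il': "(i, l) \<in> H" "l \<in> S" using il N by (auto simp: matching_def)
    have lk: "l \<noteq> k" using il ik by force
    define N0 where "N0 = N - {(i, l)}"
    have N0: "matching S B H N0" unfolding N0_def using matching_subset[OF N] by blast
    have finN0: "finite N0" using finN by (simp add: N0_def)
    have wN0: "welfare v N0 = welfare v N - v i l"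
      unfolding N0_def by (rule welfare_remove[OF finN il])
    have iN0: "i \<notin> fst ` N0" using N il unfolding N0_def matching_def inj_on_def by force
    have lN0: "l \<notin> snd ` N0" using N il unfolding N0_def matching_def inj_on_def by force
    have kN0: "k \<notin> snd ` N0" using ik by (auto simp: N0_def)
    show ?thesis
    proof (cases "l \<in> snd ` A")
      case False
      let ?N1 = "insert (i, k) N0" and ?N2 = "insert (i, l) A"
      have "matching S B H ?N1" using matching_insert[OF N0] ik iN0 kN0 by blast
      moreover have "matching S B H ?N2" using matching_insert[OF A] il' ik False by blast
      moreover have "welfare v ?N1 = v i k + welfare v N0"
        using welfare_insert finN0 ikN by (metis N0_def DiffD1)
      moreover have "welfare v ?N2 = v i l + welfare v A"
        by (rule welfare_insert[OF finA ilA])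
      moreover have "?N1 \<union> ?N2 = insert (i, k) (A \<union> N)" using il by (auto simp: N0_def)
      moreover have "?N1 \<inter> ?N2 \<subseteq> A \<inter> N" using lk ikA by (auto simp: N0_def)
      moreover have "snd ` ?N1 \<subseteq> insert k (snd ` N)" by (auto simp: N0_def)
      ultimately show ?thesis
        using wN0 by - (rule exI[of _ ?N1], rule exI[of _ ?N2], auto)
    next
      case True
      then obtain b where bl: "(b, l) \<in> A" by force
      define A0 where "A0 = A - {(b, l)}"
      have A0: "matching S B H A0" unfolding A0_def using matching_subset[OF A] by blast
      have wA0: "welfare v A0 = welfare v A - v b l"
        unfolding A0_def by (rule welfare_remove[OF finA bl])
      have bA0: "b \<notin> fst ` A0" using A bl unfolding A0_def matching_def inj_on_def by force
      have lA0: "l \<notin> snd ` A0" using A bl unfolding A0_def matching_def inj_on_def by force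
      have iA0: "i \<notin> fst ` A0" using ik by (auto simp: A0_def)
      have bi: "b \<noteq> i" using bl ik by force
      have bl': "(b, l) \<in> H" "b \<in> B" using bl A by (auto simp: matching_def)
      have "card N0 < card N" unfolding N0_def using finN il by (rule card_Diff1_less)
      from less.hyps[OF this A0 N0 bl'(1,2) il'(2) bA0 lN0]
      obtain N1 N2 where
        m: "matching S B H N1" "matching S B H N2"
        and w: "welfare v N1 + welfare v N2 = welfare v A0 + welfare v N0 + v b l"
        and u: "N1 \<union> N2 = insert (b, l) (A0 \<union> N0)" and int: "N1 \<inter> N2 \<subseteq> A0 \<inter> N0"
        and e: "(b, l) \<in> N1" and s: "snd ` N1 \<subseteq> insert l (snd ` N0)"
        by (elim exE conjE) (rule that)
      let ?N1 = "insert (i, k) N1" and ?N2 = "insert (i, l) N2"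
      have "fst ` (N1 \<union> N2) = insert b (fst ` A0 \<union> fst ` N0)" unfolding u by auto
      then have "i \<notin> fst ` (N1 \<union> N2)" using iA0 iN0 bi by simp
      then have i1: "i \<notin> fst ` N1" and i2: "i \<notin> fst ` N2" by (simp_all add: image_Un)
      have k1: "k \<notin> snd ` N1" using s lk kN0 by blast
      have l2: "l \<notin> snd ` N2"
      proof
        assume "l \<in> snd ` N2"
        then obtain c where c: "(c, l) \<in> N2" by force
        then have "(c, l) \<in> insert (b, l) (A0 \<union> N0)" using u by blast
        then have "c = b" using lA0 lN0 by force
        then have "(b, l) \<in> N1 \<inter> N2" using c e by blast
        then show False using int lN0 by force
      qed
      have "matching S B H ?N1" using matching_insert[OF m(1)] ik i1 k1 by blast
      moreover have "matching S B H ?N2" using matching_insert[OF m(2)] il' ik i2 l2 by blast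
      moreover have "welfare v ?N1 = v i k + welfare v N1"
        using welfare_insert matching_finite[OF fin m(1)] i1 by (metis fst_conv image_eqI)
      moreover have "welfare v ?N2 = v i l + welfare v N2"
        using welfare_insert matching_finite[OF fin m(2)] i2 by (metis fst_conv image_eqI)
      moreover have "?N1 \<union> ?N2 = insert (i, k) (A \<union> N)"
      proof -
        have "?N1 \<union> ?N2 = insert (i, k) (insert (i, l) (N1 \<union> N2))" by blast
        then show ?thesis unfolding u using il bl by (auto simp: N0_def A0_def)
      qed
      moreover have "?N1 \<inter> ?N2 \<subseteq> A \<inter> N"
      proof
        fix x assume x: "x \<in> ?N1 \<inter> ?N2"
        have "(i, k) \<notin> ?N2" "(i, l) \<notin> ?N1" using i1 i2 lk by force+
        then have "x \<in> N1 \<inter> N2" using x by blast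
        then show "x \<in> A \<inter> N" using int by (auto simp: A0_def N0_def)
      qed
      moreover have "snd ` ?N1 \<subseteq> insert k (snd ` N)"
        using s il by (force simp: N0_def)
      ultimately show ?thesis
        using w wN0 wA0 by - (rule exI[of _ ?N1], rule exI[of _ ?N2], auto)
    qed
  qed
qed

lemma price_competitive:
  assumes mk: "market S B v H"
  shows "competitive_prices S B v H (price S B v H)"
proof -
  have fin: "finite S" "finite B" and HS: "H \<subseteq> B \<times> S" using mk by (auto simp: market_def)
  have fin': "finite (S - {j})" for j using fin by simp
  obtain M where M: "matching S B H M" and wM: "welfare v M = max_welfare S B v H"
    using max_welfare_attained[OF fin] by blast
  have finM: "finite M" using matching_finite[OF fin M] .
  have nonneg: "0 \<le> price S B v H j" for j
  proof -
    obtain N where "matching (S - {j}) B H N" "welfare v N = max_welfare (S - {j}) B v H"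
      using max_welfare_attained[OF fin' fin(2)] by blast
    then show ?thesis
      using welfare_le_max_welfare[OF fin matching_mono, of "S - {j}" H N v]
      by (auto simp: price_def)
  qed
  have zero: "price S B v H j = 0" if "j \<notin> snd ` M" for j
    using welfare_le_max_welfare[OF fin' fin(2) matching_avoid[OF M that], of v] nonneg[of j] wM
    by (simp add: price_def)
  have ir: "price S B v H j \<le> v i j" if "(i, j) \<in> M" for i j
  proof -
    have "j \<notin> snd ` (M - {(i, j)})" using M that unfolding matching_def inj_on_def by force
    then have "matching (S - {j}) B H (M - {(i, j)})"
      using matching_avoid[OF matching_subset[OF M Diff_subset]] by simp
    from welfare_le_max_welfare[OF fin' fin(2) this, of v]
    show ?thesis using welfare_remove[OF finM that, of v] wM by (simp add: price_def)
  qed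
  have unmatched: "v i k \<le> price S B v H k" if i: "i \<notin> fst ` M" and ik: "(i, k) \<in> H" for i k
  proof -
    obtain N where N: "matching (S - {k}) B H N" "welfare v N = max_welfare (S - {k}) B v H"
      using max_welfare_attained[OF fin' fin(2)] by blast
    have k: "k \<notin> snd ` N" using N by (auto simp: matching_def)
    obtain N1 N2 where "matching S B H N1" "matching S B H N2"
      "welfare v N1 + welfare v N2 = welfare v M + welfare v N + v i k"
      using rematch[OF fin M matching_mono[OF N(1)] ik _ _ i k, of v] ik HS by blast
    then show ?thesis
      using welfare_le_max_welfare[OF fin, of H N1 v] welfare_le_max_welfare[OF fin, of H N2 v] N wM
      by (simp add: price_def)
  qed
  have envy_free: "v i k - price S B v H k \<le> v i j - price S B v H j"
    if ij: "(i, j) \<in> M" and ik: "(i, k) \<in> H" for i j k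
  proof (cases "j = k")
    case False
    obtain N where N: "matching (S - {k}) B H N" "welfare v N = max_welfare (S - {k}) B v H"
      using max_welfare_attained[OF fin' fin(2)] by blast
    have k: "k \<notin> snd ` N" using N by (auto simp: matching_def)
    let ?A = "M - {(i, j)}"
    have A: "matching S B H ?A" using matching_subset[OF M] by blast
    have iA: "i \<notin> fst ` ?A" and jA: "j \<notin> snd ` ?A"
      using M ij unfolding matching_def inj_on_def by force+
    have wA: "welfare v ?A = welfare v M - v i j" by (rule welfare_remove[OF finM ij])
    obtain N1 N2 where m: "matching S B H N1" "matching S B H N2"
      and w: "welfare v N1 + welfare v N2 = welfare v ?A + welfare v N + v i k"
      and u: "N1 \<union> N2 = insert (i, k) (?A \<union> N)" and int: "N1 \<inter> N2 \<subseteq> ?A \<inter> N"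
      using rematch[OF fin A matching_mono[OF N(1)] ik _ _ iA k, of v] ik HS by blast
    have jN: "(c, j) \<in> N" if "(c, j) \<in> N1 \<union> N2" for c using that u jA False by force
    have "j \<notin> snd ` N1 \<or> j \<notin> snd ` N2"
    proof (rule ccontr)
      assume "\<not> ?thesis"
      then obtain c d where cd: "(c, j) \<in> N1" "(d, j) \<in> N2" by force
      then have "(c, j) \<in> N" "(d, j) \<in> N" using jN by blast+
      then have "c = d" using N(1) unfolding matching_def inj_on_def by force
      then show False using cd int jA by force
    qed
    moreover have "welfare v X + welfare v Y \<le> max_welfare S B v H + max_welfare (S - {j}) B v H"
      if "matching S B H X" "matching S B H Y" "j \<notin> snd ` Y" for X Y
      using welfare_le_max_welfare[OF fin that(1), of v]
        welfare_le_max_welfare[OF fin' fin(2) matching_avoid[OF that(2,3)], of v] by simp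
    ultimately have "welfare v N1 + welfare v N2
        \<le> max_welfare S B v H + max_welfare (S - {j}) B v H"
      using m by (metis add.commute)
    then show ?thesis using w wA wM N by (simp add: price_def)
  qed simp
  have "competitive_equilibrium S B v H M (price S B v H)"
    unfolding competitive_equilibrium_def
    using M nonneg zero ir envy_free unmatched by (auto 0 3)
  then show ?thesis by (auto simp: competitive_prices_def)
qed

lemma competitive_prices_le_price:
  assumes mk: "market S B v H" and cp: "competitive_prices S B v H p" and j: "j \<in> S"
  shows "p j \<le> price S B v H j"
proof -
  have fin: "finite S" "finite B" using mk by (auto simp: market_def)
  have fin': "finite (S - {j})" using fin by simp
  obtain M where M: "competitive_equilibrium S B v H M p"
    using cp by (auto simp: competitive_prices_def)
  have mM: "matching S B H M" and p0: "\<And>j. j \<in> S \<Longrightarrow> 0 \<le> p j"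
    and unsold: "\<And>j. j \<in> S - snd ` M \<Longrightarrow> p j = 0"
    and dem: "\<And>i j. (i, j) \<in> M \<Longrightarrow> 0 \<le> v i j - p j"
      "\<And>i j k. (i, j) \<in> M \<Longrightarrow> (i, k) \<in> H \<Longrightarrow> v i k - p k \<le> v i j - p j"
    and undem: "\<And>i k. i \<in> B - fst ` M \<Longrightarrow> (i, k) \<in> H \<Longrightarrow> v i k - p k \<le> 0"
    using M unfolding competitive_equilibrium_def by blast+
  have finM: "finite M" using matching_finite[OF fin mM] .
  have injM: "inj_on fst M" "inj_on snd M" and subM: "fst ` M \<subseteq> B" "snd ` M \<subseteq> S"
    using mM by (auto simp: matching_def)
  define u where "u i = (if i \<in> fst ` M then v i (snd (the_inv_into M fst i))
                            - p (snd (the_inv_into M fst i)) else 0)" for i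
  have u_M: "u i = v i j - p j" if "(i, j) \<in> M" for i j
    using that the_inv_into_f_f[OF injM(1) that] by (force simp: u_def)
  have u0: "0 \<le> u i" for i
  proof (cases "i \<in> fst ` M")
    case True
    then obtain l where "(i, l) \<in> M" by force
    then show ?thesis using u_M dem(1) by metis
  qed (simp add: u_def)
  have u_H: "v i k \<le> u i + p k" if "(i, k) \<in> H" "i \<in> B" for i k
  proof (cases "i \<in> fst ` M")
    case True
    then obtain l where "(i, l) \<in> M" by force
    then show ?thesis using u_M[of i l] dem(2)[of i l k] that by simp
  next
    case False
    then show ?thesis using undem[of i k] that by (simp add: u_def)
  qed
  have "welfare v M = (\<Sum>x\<in>M. u (fst x) + p (snd x))"
    unfolding welfare_def by (rule sum.cong) (auto simp: u_M)
  also have "\<dots> = (\<Sum>i\<in>fst ` M. u i) + (\<Sum>k\<in>snd ` M. p k)"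
    by (simp add: sum.distrib sum.reindex[OF injM(1)] sum.reindex[OF injM(2)])
  also have "(\<Sum>i\<in>fst ` M. u i) = (\<Sum>i\<in>B. u i)"
    using fin subM by (intro sum.mono_neutral_left) (auto simp: u_def)
  also have "(\<Sum>k\<in>snd ` M. p k) = (\<Sum>k\<in>S. p k)"
    using fin subM unsold by (intro sum.mono_neutral_left) auto
  finally have wM: "welfare v M = sum u B + sum p S" .
  obtain N where N: "matching (S - {j}) B H N" "welfare v N = max_welfare (S - {j}) B v H"
    using max_welfare_attained[OF fin' fin(2)] by blast
  have injN: "inj_on fst N" "inj_on snd N" and subN: "fst ` N \<subseteq> B" "snd ` N \<subseteq> S - {j}"
    and NH: "N \<subseteq> H" using N(1) by (auto simp: matching_def)
  have "welfare v N \<le> (\<Sum>x\<in>N. u (fst x) + p (snd x))"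
    unfolding welfare_def
  proof (rule sum_mono)
    fix x assume x: "x \<in> N"
    then have "(fst x, snd x) \<in> H" "fst x \<in> B" using NH subN by auto
    from u_H[OF this] show "(case x of (i, j) \<Rightarrow> v i j) \<le> u (fst x) + p (snd x)"
      by (simp add: case_prod_beta)
  qed
  also have "\<dots> = (\<Sum>i\<in>fst ` N. u i) + (\<Sum>k\<in>snd ` N. p k)"
    by (simp add: sum.distrib sum.reindex[OF injN(1)] sum.reindex[OF injN(2)])
  also have "\<dots> \<le> sum u B + sum p (S - {j})"
    using fin fin' subN u0 p0 by (intro add_mono sum_mono2) auto
  finally have "max_welfare (S - {j}) B v H \<le> sum u B + sum p S - p j"
    using N(2) fin(1) j by (simp add: sum_diff1)
  then show ?thesis
    using wM welfare_le_max_welfare[OF fin mM, of v] by (simp add: price_def)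
qed

theorem price_is_max_competitive_price:
  assumes "market S B v H"
  shows "competitive_prices S B v H (price S B v H)"
    and "\<And>p j. competitive_prices S B v H p \<Longrightarrow> j \<in> S \<Longrightarrow> p j \<le> price S B v H j"
  by (rule price_competitive[OF assms], rule competitive_prices_le_price[OF assms])

corollary platform_price_is_max_competitive_price:
  assumes "market S B v G" "P \<subseteq> S"
  shows "competitive_prices S B v (platform_graph B G P) (platform_price S B v G P)"
    and "\<And>p j. competitive_prices S B v (platform_graph B G P) p \<Longrightarrow> j \<in> S \<Longrightarrow>
            p j \<le> platform_price S B v G P j"
proof -
  have "market S B v (platform_graph B G P)"
    using assms by (auto simp: market_def platform_graph_def)
  then show "competitive_prices S B v (platform_graph B G P) (platform_price S B v G P)"
    and "\<And>p j. competitive_prices S B v (platform_graph B G P) p \<Longrightarrow> j \<in> S \<Longrightarrow>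
            p j \<le> platform_price S B v G P j"
    using price_is_max_competitive_price[of S B v "platform_graph B G P"]
    by (simp_all add: platform_price_def[abs_def])
qed

end

theory Submission
  imports Defs
begin

text \<open>
  Three buyers, three sellers and \<open>1 - \<alpha> = 1/4\<close>. Seller 3 is linked to every buyer already, so
  joining would only cost it the fee, and it stays out. Sellers 1 and 2 then play matching pennies:
  seller 2 joins while seller 1 is out, which drops the price of seller 1 to 0; seller 1 then
  joins to recover it; this raises the outside option of seller 2 enough for it to leave; and then
  seller 1 leaves too. The prices are computed by dynamic programming over the buyers.
\<close>

text \<open>Either buyer \<open>i\<close> stays unmatched or exactly one edge \<open>(i, j)\<close>
  meets it; injectivity then keeps all other edges away from both \<open>i\<close> and
  \<open>j\<close>.\<close>

lemma matching_insert_buyer_iff: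
  assumes "i \<notin> B"
  shows "matching S (insert i B) H M \<longleftrightarrow>
    matching S B H M \<or>
    (\<exists>j\<in>S. (i, j) \<in> H \<and> (\<exists>N. matching (S - {j}) B H N \<and> M = insert (i, j) N))"
    (is "?L \<longleftrightarrow> ?R")
proof
  assume L: ?L
  show ?R
  proof (cases "i \<in> fst ` M")
    case False
    have "M \<subseteq> H \<inter> B \<times> S"
    proof
      fix x assume x: "x \<in> M"
      then have "fst x \<noteq> i" using False by blast
      then show "x \<in> H \<inter> B \<times> S" using x L by (auto simp: matching_def)
    qed
    then show ?thesis using L by (simp add: matching_def)
  next
    case True
    then obtain j where ij: "(i, j) \<in> M" by force
    define N where "N = M - {(i, j)}"
    have "i \<notin> fst ` N" "j \<notin> snd ` N"
      using L ij unfolding N_def matching_def inj_on_def by force+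
    then have "\<forall>x\<in>N. fst x \<noteq> i \<and> snd x \<noteq> j" by blast
    moreover have "matching S (insert i B) H N"
      unfolding N_def using matching_subset[OF L] by blast
    ultimately have "matching (S - {j}) B H N" unfolding matching_def by fastforce
    moreover have "M = insert (i, j) N" using ij by (auto simp: N_def)
    moreover have "j \<in> S" "(i, j) \<in> H" using L ij by (auto simp: matching_def)
    ultimately show ?thesis by blast
  qed
next
  assume ?R
  then show ?L
  proof (elim disjE bexE conjE exE)
    assume "matching S B H M"
    then show ?L by (auto simp: matching_def)
  next
    fix j N assume j: "j \<in> S" "(i, j) \<in> H" and N: "matching (S - {j}) B H N"
      and M: "M = insert (i, j) N"
    have "matching S (insert i B) H N" using N by (auto simp: matching_def)
    moreover have "i \<notin> fst ` N" "j \<notin> snd ` N" using N assms by (auto simp: matching_def)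
    ultimately show ?L unfolding M using j by (intro matching_insert) auto
  qed
qed

text \<open>This is the recursion of the dynamic program: buyer \<open>i\<close> is skipped or takes
  a seller, which is then removed. The maximum runs over all of \<open>S\<close> so that it can be
  evaluated for explicit sets; a non-edge merely repeats the value of skipping.\<close>

lemma max_welfare_insert_buyer:
  assumes S: "finite S" and B: "finite B" and i: "i \<notin> B"
  shows "max_welfare S (insert i B) v H =
    Max (insert (max_welfare S B v H)
      ((\<lambda>j. if (i, j) \<in> H then v i j + max_welfare (S - {j}) B v H else max_welfare S B v H) ` S))"
    (is "?W = Max ?A")
proof (rule antisym)
  have finA: "finite ?A" using S by simp
  have edge: "matching S (insert i B) H (insert (i, j) N)"
      "welfare v (insert (i, j) N) = v i j + welfare v N"
    if "j \<in> S" "(i, j) \<in> H" "matching (S - {j}) B H N" for j N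
  proof -
    show "matching S (insert i B) H (insert (i, j) N)"
      using that matching_insert_buyer_iff[OF i] by blast
    have "finite N" using matching_finite S B that(3) by blast
    moreover have "(i, j) \<notin> N" using that(3) i by (auto simp: matching_def)
    ultimately show "welfare v (insert (i, j) N) = v i j + welfare v N" by (rule welfare_insert)
  qed
  obtain M where M: "matching S (insert i B) H M" and wM: "welfare v M = ?W"
    using max_welfare_attained[OF S, of "insert i B" H v] B by auto
  from M[unfolded matching_insert_buyer_iff[OF i]] show "?W \<le> Max ?A"
  proof (elim disjE bexE conjE exE)
    assume "matching S B H M"
    then have "?W \<le> max_welfare S B v H" using welfare_le_max_welfare[OF S B] wM by metis
    also have "\<dots> \<le> Max ?A" using finA by (intro Max_ge) auto
    finally show ?thesis .
  next
    fix j N assume j: "j \<in> S" "(i, j) \<in> H" and N: "matching (S - {j}) B H N"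
      and MN: "M = insert (i, j) N"
    have "?W = v i j + welfare v N" using wM edge(2)[OF j N] MN by simp
    also have "\<dots> \<le> v i j + max_welfare (S - {j}) B v H"
      using welfare_le_max_welfare[OF _ B N] S by simp
    also have "\<dots> \<le> Max ?A" using finA j by (intro Max_ge) force+
    finally show ?thesis .
  qed
  have skip: "max_welfare S B v H \<le> ?W"
  proof -
    obtain M where "matching S B H M" "welfare v M = max_welfare S B v H"
      using max_welfare_attained[OF S B] by blast
    then show ?thesis
      using welfare_le_max_welfare[OF S _ , of "insert i B" H M v] matching_insert_buyer_iff[OF i] B
      by auto
  qed
  have "v i j + max_welfare (S - {j}) B v H \<le> ?W" if j: "j \<in> S" "(i, j) \<in> H" for j
  proof -
    obtain N where N: "matching (S - {j}) B H N" "welfare v N = max_welfare (S - {j}) B v H"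
      using max_welfare_attained[of "S - {j}" B] S B by blast
    then show ?thesis
      using welfare_le_max_welfare[OF S _ edge(1)[OF j N(1)], of v] edge(2)[OF j N(1)] B by simp
  qed
  then show "Max ?A \<le> ?W" using skip finA by (intro Max.boundedI) auto
qed

lemma max_welfare_no_buyers: "max_welfare S {} v H = 0"
proof -
  have "{M. matching S {} H M} = {{}}" by (auto simp: matching_def)
  then show ?thesis by (simp add: max_welfare_def welfare_def)
qed

text \<open>Rows belong to buyers and columns to sellers; the shift by 1 is there because list
  positions start at 0.\<close>

definition cycle_values :: "nat \<Rightarrow> nat \<Rightarrow> real" where
  "cycle_values i j = [[2, 3, 3], [2, 1, 3], [2, 0, 0]] ! (i - 1) ! (j - 1)"

text \<open>Only buyer 2 reaches sellers 1 and 2 directly, so either of them gains exactly buyers 1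
  and 3 by joining.\<close>

definition cycle_graph :: "(nat \<times> nat) set" where
  "cycle_graph = {(1, 3), (2, 1), (2, 2), (2, 3), (3, 3)}"

abbreviation cycle_price :: "nat set \<Rightarrow> nat \<Rightarrow> real" where
  "cycle_price \<equiv> platform_price {1..3} {1..3} cycle_values cycle_graph"

lemma atLeastAtMost_1_3: "{1..3::nat} = {1, 2, 3}"
  by auto

lemma cycle_values_simps:
  "cycle_values 1 1 = 2" "cycle_values 1 2 = 3" "cycle_values 1 3 = 3"
  "cycle_values 2 1 = 2" "cycle_values 2 2 = 1" "cycle_values 2 3 = 3"
  "cycle_values 3 1 = 2" "cycle_values 3 2 = 0" "cycle_values 3 3 = 0"
  by (simp_all add: cycle_values_def)

lemma market_cycle: "market {1..3} {1..3} cycle_values cycle_graph"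
  unfolding market_def atLeastAtMost_1_3 by (auto simp: cycle_graph_def cycle_values_def)

lemma platform_graph_cycle_iff:
  "(1, 1) \<in> platform_graph {1..3} cycle_graph P \<longleftrightarrow> 1 \<in> P"
  "(1, 2) \<in> platform_graph {1..3} cycle_graph P \<longleftrightarrow> 2 \<in> P"
  "(1, 3) \<in> platform_graph {1..3} cycle_graph P"
  "(2, 1) \<in> platform_graph {1..3} cycle_graph P"
  "(2, 2) \<in> platform_graph {1..3} cycle_graph P"
  "(2, 3) \<in> platform_graph {1..3} cycle_graph P"
  "(3, 1) \<in> platform_graph {1..3} cycle_graph P \<longleftrightarrow> 1 \<in> P"
  "(3, 2) \<in> platform_graph {1..3} cycle_graph P \<longleftrightarrow> 2 \<in> P"
  "(3, 3) \<in> platform_graph {1..3} cycle_graph P"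
  by (auto simp: platform_graph_def cycle_graph_def)

lemma cycle_price_eq:
  "cycle_price P j =
    max_welfare {1, 2, 3} {1, 2, 3} cycle_values (platform_graph {1..3} cycle_graph P) -
    max_welfare ({1, 2, 3} - {j}) {1, 2, 3} cycle_values (platform_graph {1..3} cycle_graph P)"
  by (simp only: platform_price_def price_def atLeastAtMost_1_3)

text \<open>Rewriting with these rules removes buyers one by one until none is left;
  \<open>insert_Diff_if\<close> evaluates the shrinking seller sets.\<close>

lemmas compute_price =
  cycle_price_eq max_welfare_insert_buyer max_welfare_no_buyers cycle_values_simps
  platform_graph_cycle_iff insert_Diff_if

text \<open>
  Used as a congruence rule, this keeps the simplifier from unfolding the recursion for a bound
  seller \<open>j\<close> before the image is expanded.
\<close>

lemma image_weak_cong: "A = A' \<Longrightarrow> f ` A = f ` A'"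
  by simp

lemma cycle_prices_none:
  "cycle_price {} 1 = 1" "cycle_price {} 2 = 0" "cycle_price {} 3 = 3"
  \<comment> \<open>Without \<open>One_nat_def\<close>, the index 1 keeps the form in which the
    rules for values and edges mention it.\<close>
  by (simp_all add: compute_price del: One_nat_def cong: image_weak_cong)

lemma cycle_prices_1:
  "cycle_price {1} 1 = 2" "cycle_price {1} 2 = 1" "cycle_price {1} 3 = 3"
  by (simp_all add: compute_price del: One_nat_def cong: image_weak_cong)

text \<open>The optimum gives seller 2 to buyer 1 and seller 3 to buyer 2, the only neighbour of
  seller 1. Seller 1 is thus unsold at price 0.\<close>

lemma cycle_prices_2:
  "cycle_price {2} 1 = 0" "cycle_price {2} 2 = 1" "cycle_price {2} 3 = 1"
  by (simp_all add: compute_price del: One_nat_def cong: image_weak_cong)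

lemma cycle_prices_1_2:
  "cycle_price {1, 2} 1 = 2" "cycle_price {1, 2} 2 = 3" "cycle_price {1, 2} 3 = 3"
  by (simp_all add: compute_price del: One_nat_def cong: image_weak_cong)

lemmas cycle_prices = cycle_prices_none cycle_prices_1 cycle_prices_2 cycle_prices_1_2

text \<open>Seller 3 is adjacent to every buyer in \<open>cycle_graph\<close>, so its joining adds
  no edge.\<close>

lemma cycle_price_insert_3: "cycle_price (insert 3 P) = cycle_price P"
proof -
  have "platform_graph {1..3} cycle_graph (insert 3 P) = platform_graph {1..3} cycle_graph P"
    unfolding platform_graph_def cycle_graph_def atLeastAtMost_1_3 by auto
  then show ?thesis by (simp add: platform_price_def[abs_def])
qed

text \<open>The fee 3/4 is one choice among many: the deviations below are profitable whenever 0 < 1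
  - \<alpha> < 1/3.\<close>

lemma no_equilibrium_cycle:
  "\<not> pure_platform_equilibrium {1..3} {1..3} cycle_values cycle_graph (3/4) P"
proof
  assume "pure_platform_equilibrium {1..3} {1..3} cycle_values cycle_graph (3/4) P"
  then have sub: "P \<subseteq> {1, 2, 3}"
    and stay: "\<And>j. j \<in> P \<Longrightarrow> cycle_price (P - {j}) j \<le> 1/4 * cycle_price P j"
    and out: "\<And>j. j \<in> {1, 2, 3} - P \<Longrightarrow> 1/4 * cycle_price (insert j P) j \<le> cycle_price P j"
    unfolding pure_platform_equilibrium_iff atLeastAtMost_1_3[symmetric] by auto
  have pos: "0 < cycle_price Q 3" if "Q \<subseteq> {1, 2}" for Q
  proof -
    have "Q \<in> {{}, {1}, {2}, {1, 2}}" using that by blast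
    then show ?thesis using cycle_prices by auto
  qed
  have "3 \<notin> P"
  proof
    assume 3: "3 \<in> P"
    then have "cycle_price P = cycle_price (P - {3})"
      using cycle_price_insert_3[of "P - {3}"] by (simp add: insert_absorb)
    moreover have "P - {3} \<subseteq> {1, 2}" using sub by auto
    \<comment> \<open>Staying would require p \<le> p/4 for the unchanged price p of seller 3, which
      is positive.\<close>
    ultimately show False using stay[OF 3] pos[of "P - {3}"] by simp
  qed
  then have "P \<in> {{}, {1}, {2}, {1, 2}}" using sub by blast
  then consider "P = {}" | "P = {1}" | "P = {2}" | "P = {1, 2}" by blast
  \<comment> \<open>The profitable deviations are, in order: seller 2 joins (1/4 > 0), seller 1
    leaves (1 > 2/4), seller 1 joins (2/4 > 0), seller 2 leaves (1 > 3/4).\<close>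
  then show False
  proof cases
    case 1
    then show False using out[of 2] cycle_prices by simp
  next
    case 2
    then show False using stay[of 1] cycle_prices by simp
  next
    case 3
    then show False using out[of 1] cycle_prices by simp
  next
    case 4
    then have "P - {2} = {1}" by auto
    then show False using 4 stay[of 2] cycle_prices by simp
  qed
qed

theorem proposition3p1:
  shows "\<exists>(m::nat) (n::nat) (v :: nat \<Rightarrow> nat \<Rightarrow> real) (G :: (nat \<times> nat) set) (\<alpha>::real).
           market {1..m} {1..n} v G \<and> 0 \<le> \<alpha> \<and> \<alpha> \<le> 1 \<and>
           \<not> (\<exists>P. pure_platform_equilibrium {1..m} {1..n} v G \<alpha> P)"
proof (intro exI conjI)
  show "market {1..3} {1..3} cycle_values cycle_graph" by (rule market_cycle)
  show "\<not> (\<exists>P. pure_platform_equilibrium {1..3} {1..3} cycle_values cycle_graph (3/4) P)"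
    using no_equilibrium_cycle by blast
qed simp_all

end
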